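(* Let $\mathcal{P}$ be a fixed hyper-prior and $\delta>0$. Then with probability at least $1-\delta$ over the sampling of $S_1,\dots,S_n$, simultaneously for all hyper-posteriors $\mathcal{Q}$ and all posteriors $Q_1,\dots,Q_n$, $$\sum_{i=1}^n m_i\,\mathrm{kl}\big(\widehat{\mathcal{R}}_i(Q_i)\,\big|\,\mathcal{R}_i(Q_i)\big)\;\le\;\mathrm{KL}(\mathfrak{Q}\|\mathfrak{P})+\log\frac1\delta+\sum_{i=1}^n\log\big(2\sqrt{m_i}\big).$$
   Context: Multi-task setting: $n$ tasks; task $i$ has an unknown distribution $D_i$ on $\mathcal{Z}$, a loss $\ell_i:\mathcal{F}\times\mathcal{Z}\to[0,1]$, and a training set $S_i=(z_{i1},\dots,z_{im_i})$ of $m_i\ge1$ i.i.d. samples from $D_i$, the $S_i$ mutually independent. $\mathcal{M}(\mathcal{F})$ is the set of probability distributions on $\mathcal{F}$. For $Q\in\mathcal{M}(\mathcal{F})$: $\ell_i(Q,z)=\mathbb{E}_{f\sim Q}\ell_i(f,z)$, $\mathcal{R}_i(Q)=\mathbb{E}_{z\sim D_i}\ell_i(Q,z)$, $\widehat{\mathcal{R}}_i(Q)=\frac1{m_i}\sum_{j=1}^{m_i}\ell_i(Q,z_{ij})$. Hyper-prior $\mathcal{P}$ (data-independent) and hyper-posterior $\mathcal{Q}$ are distributions on $\mathcal{M}(\mathcal{F})$; posteriors $Q_i\in\mathcal{M}(\mathcal{F})$; $\mathcal{Q},Q_i$ may depend on the data. $\mathfrak{Q}=\mathcal{Q}\times Q_1\times\cdots\times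 Q_n$ on $\mathcal{M}(\mathcal{F})\times\mathcal{F}^n$; $\mathfrak{P}$ on the same space is generated by $P\sim\mathcal{P}$, then $f_1,\dots,f_n$ i.i.d. $\sim P$. $\mathrm{KL}$ is the Kullback–Leibler divergence, and $\mathrm{kl}(q|p)=q\log\frac qp+(1-q)\log\frac{1-q}{1-p}$ (convention $0\log0=0$). *)

theory Defs
  imports "HOL-Probability.Probability"
begin

definition KL_ext :: "'a measure \<Rightarrow> 'a measure \<Rightarrow> ereal" where
  "KL_ext N M =
     (if absolutely_continuous M N \<and> integrable N (entropy_density (exp 1) M N)
      then ereal (KL_divergence (exp 1) M N) else \<infinity>)"

definition xlogxy :: "real \<Rightarrow> real \<Rightarrow> ereal" where
  "xlogxy a b = (if a = 0 then 0 else if b = 0 then \<infinity> else ereal (a * ln (a / b)))"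

definition binkl :: "real \<Rightarrow> real \<Rightarrow> ereal" where
  "binkl q p = xlogxy q p + xlogxy (1 - q) (1 - p)"

definition loss_post :: "('f \<Rightarrow> 'z \<Rightarrow> real) \<Rightarrow> 'f measure \<Rightarrow> 'z \<Rightarrow> real" where
  "loss_post l Q z = (\<integral>f. l f z \<partial>Q)"

definition true_risk :: "('f \<Rightarrow> 'z \<Rightarrow> real) \<Rightarrow> 'z measure \<Rightarrow> 'f measure \<Rightarrow> real" where
  "true_risk l D Q = (\<integral>z. loss_post l Q z \<partial>D)"

definition emp_risk :: "('f \<Rightarrow> 'z \<Rightarrow> real) \<Rightarrow> nat \<Rightarrow> (nat \<Rightarrow> 'z) \<Rightarrow> 'f measure \<Rightarrow> real" where
  "emp_risk l m s Q = (1 / real m) * (\<Sum>j<m. loss_post l Q (s j))"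

definition joint_post :: "'f measure \<Rightarrow> nat \<Rightarrow> 'f measure measure \<Rightarrow> (nat \<Rightarrow> 'f measure)
     \<Rightarrow> ('f measure \<times> (nat \<Rightarrow> 'f)) measure" where
  "joint_post MF n hQ Qs = hQ \<Otimes>\<^sub>M (\<Pi>\<^sub>M i\<in>{..<n}. Qs i)"

definition joint_prior :: "'f measure \<Rightarrow> nat \<Rightarrow> 'f measure measure
     \<Rightarrow> ('f measure \<times> (nat \<Rightarrow> 'f)) measure" where
  "joint_prior MF n hP = hP \<bind> (\<lambda>P. distr (\<Pi>\<^sub>M i\<in>{..<n}. P)
       (prob_algebra MF \<Otimes>\<^sub>M (\<Pi>\<^sub>M i\<in>{..<n}. MF)) (\<lambda>fs. (P, fs)))"

definition sample_space :: "nat \<Rightarrow> (nat \<Rightarrow> nat) \<Rightarrow> (nat \<Rightarrow> 'z measure)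
     \<Rightarrow> (nat \<Rightarrow> nat \<Rightarrow> 'z) measure" where
  "sample_space n m D = (\<Pi>\<^sub>M i\<in>{..<n}. \<Pi>\<^sub>M j\<in>{..<m i}. D i)"

end

theory Submission
  imports Defs
begin

text \<open>
  Let \<open>x\<^sub>1, \<dots>, x\<^sub>m\<close> be the losses of a fixed predictor on one task, with mean \<open>p\<close>. For every \<open>q\<close> the
  product of the factors \<open>x\<^sub>j q / p + (1 - x\<^sub>j) (1 - q) / (1 - p)\<close> has expectation 1, and by
  concavity of the logarithm the one with \<open>q\<close> the empirical mean dominates \<open>exp (m kl(q|p))\<close>.
  Averaging the products over \<open>q\<close> with the Beta(1/2, 1/2) (Krichevsky--Trofimov) weights gives a
  polynomial in the \<open>x\<^sub>j\<close>, still of expectation 1, which loses at most the factor \<open>2 sqrt m\<close> against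
  the best \<open>q\<close>. This yields Maurer's bound \<open>E exp (m kl) \<le> 2 sqrt m\<close> for all \<open>m \<ge> 1\<close>. Fubini and
  Markov's inequality turn it into an event on which the expectation under the joint prior of the
  product over the tasks is at most \<open>(1 / \<delta>) \<Prod>\<^sub>i 2 sqrt m\<^sub>i\<close>. On that event the
  Donsker--Varadhan inequality is applied not to \<open>kl\<close> itself but to its tangent plane at the
  averaged risks, which builds in Jensen's inequality for the jointly convex function \<open>kl\<close>.
\<close>

subsection \<open>Krichevsky--Trofimov probabilities\<close>

text \<open>With \<open>m = a + b\<close>, the quotient of \<open>kt_prob a b\<close> by the maximal
  likelihood \<open>a^a b^b / m^m\<close> is \<open>kt_half a * kt_half b * m^m / m!\<close>.
  Comparing the two thus reduces to a function of one variable.\<close>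

definition kt_half :: "nat \<Rightarrow> real" where
  "kt_half a = pochhammer (1/2) a / real a ^ a"

definition kt_ratio :: "nat \<Rightarrow> real" where
  "kt_ratio a = (real a + 1/2) * real a ^ a / real (Suc a) ^ Suc a"

text \<open>The probability of a fixed binary string with \<open>a\<close> ones and \<open>b\<close> zeros when the bias has
  the Beta(1/2, 1/2) distribution.\<close>

definition kt_prob :: "nat \<Rightarrow> nat \<Rightarrow> real" where
  "kt_prob a b = pochhammer (1/2) a * pochhammer (1/2) b / fact (a + b)"

lemma kt_half_Suc: "kt_half (Suc a) = kt_half a * kt_ratio a"
  by (cases "a = 0") (simp_all add: kt_half_def kt_ratio_def pochhammer_Suc mult_ac add_ac)

lemma kt_half_pos: "kt_half a > 0"
  by (cases "a = 0") (auto simp: kt_half_def intro!: divide_pos_pos pochhammer_pos)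

text \<open>The logarithm of \<open>kt_ratio\<close> extends to real \<open>x > 0\<close> with
  derivative \<open>1/(x + 1/2) - ln ((x + 1)/x)\<close>, nonpositive by the midpoint rule for the
  convex function \<open>1/t\<close> on \<open>[x, x + 1]\<close>. The step from 0 to 1 is computed
  directly.\<close>

lemma kt_ratio_Suc_le: "kt_ratio (Suc a) \<le> kt_ratio a"
proof (cases "a = 0")
  case True
  then show ?thesis by (simp add: kt_ratio_def power2_eq_square)
next
  case False
  let ?f = "\<lambda>x::real. ln (x + 1/2) + x * ln x - (x + 1) * ln (x + 1)"
  have f: "kt_ratio k = exp (?f (real k))" if "k > 0" for k
  proof -
    have "exp (real k * ln (real k)) = real k ^ k"
      using that by (simp add: exp_of_nat_mult)
    moreover have "exp ((real k + 1) * ln (real k + 1)) = real (Suc k) ^ Suc k"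
      using exp_of_nat_mult[of "Suc k" "ln (real k + 1)"] that by (simp add: add.commute)
    ultimately show ?thesis
      using that by (simp add: exp_add exp_diff kt_ratio_def)
  qed
  have "?f (real (Suc a)) \<le> ?f (real a)"
  proof (rule DERIV_nonpos_imp_nonincreasing[where f = ?f])
    fix x assume x: "real a \<le> x" "x \<le> real (Suc a)"
    then have "x > 0" using False by linarith
    then have "(?f has_real_derivative (1 / (x + 1/2) + ln x - ln (x + 1))) (at x)"
      by (auto intro!: derivative_eq_intros)
    moreover have "1 / (x + 1/2) + ln x - ln (x + 1) \<le> 0"
      using ln_inverse_approx_ge[of x "x + 1"] \<open>x > 0\<close> by (simp add: field_simps)
    ultimately show "\<exists>y. (?f has_real_derivative y) (at x) \<and> y \<le> 0"
      by blast
  qed simp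
  then show ?thesis
    using False f[of a] f[of "Suc a"] by simp
qed

text \<open>Raising \<open>a\<close> by one multiplies the left side by
  \<open>kt_ratio (a + b)\<close> and the right side by \<open>kt_ratio a\<close>, which is at least
  as large because \<open>kt_ratio\<close> decreases.\<close>

lemma kt_half_submult: "kt_half (a + b) \<le> kt_half a * kt_half b"
proof (induction a)
  case 0
  then show ?case by (simp add: kt_half_def)
next
  case (Suc a)
  have "kt_ratio (a + b) \<le> kt_ratio a"
    by (rule lift_Suc_antimono_le[of kt_ratio]) (auto intro: kt_ratio_Suc_le)
  moreover have "kt_ratio (a + b) \<ge> 0"
    by (simp add: kt_ratio_def)
  ultimately have "kt_half (a + b) * kt_ratio (a + b) \<le> (kt_half a * kt_half b) * kt_ratio a"
    using Suc kt_half_pos by (intro mult_mono) (auto simp: less_imp_le)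
  then show ?case
    by (simp add: kt_half_Suc mult_ac)
qed

text \<open>The induction step is AM-GM, \<open>sqrt (m (m + 1)) \<le> m + 1/2\<close>. Equivalent
  to the lower bound \<open>4^m / (2 sqrt m)\<close> on the central binomial coefficient, with
  equality at \<open>m = 1\<close>; the source of the factor \<open>2 sqrt m\<close>.\<close>

lemma pochhammer_half_lower:
  assumes "m \<ge> 1"
  shows "fact m \<le> 2 * sqrt (real m) * pochhammer (1/2) m"
  using assms
proof (induction m rule: nat_induct_at_least)
  case base
  then show ?case by simp
next
  case (Suc m)
  have "sqrt (real (Suc m)) * sqrt (real m) \<le> real m + 1/2"
    by (rule power2_le_imp_le) (auto simp: power2_eq_square algebra_simps)
  then have *: "real (Suc m) * sqrt (real m) \<le> sqrt (real (Suc m)) * (real m + 1/2)"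
    using mult_left_mono[of "sqrt (real (Suc m)) * sqrt (real m)" "real m + 1/2" "sqrt (real (Suc m))"]
    by (simp flip: mult.assoc)
  have "fact (Suc m) = real (Suc m) * fact m"
    by simp
  also have "\<dots> \<le> real (Suc m) * (2 * sqrt (real m) * pochhammer (1/2) m)"
    using Suc by (intro mult_left_mono) auto
  also have "\<dots> = 2 * pochhammer (1/2) m * (real (Suc m) * sqrt (real m))"
    by (simp add: algebra_simps)
  also have "\<dots> \<le> 2 * pochhammer (1/2) m * (sqrt (real (Suc m)) * (real m + 1/2))"
    by (intro mult_left_mono *) (auto intro!: pochhammer_nonneg)
  also have "\<dots> = 2 * sqrt (real (Suc m)) * pochhammer (1/2) (Suc m)"
    by (simp add: pochhammer_Suc algebra_simps)
  finally show ?case .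
qed

lemma kt_prob_pos: "kt_prob a b > 0"
  by (auto simp: kt_prob_def intro!: divide_pos_pos mult_pos_pos pochhammer_pos)

text \<open>Weighted AM-GM, from convexity of \<open>exp\<close>. Since \<open>ln 0 = 0\<close>, a
  vanishing \<open>u\<close> or \<open>v\<close> would enter the left side as the factor 1, so it is
  allowed only with weight 0.\<close>

lemma exp_weighted_ln_le:
  fixes x u v :: real
  assumes "0 \<le> x" "x \<le> 1" "u \<ge> 0" "v \<ge> 0" "u = 0 \<Longrightarrow> x = 0" "v = 0 \<Longrightarrow> x = 1"
  shows "exp (x * ln u + (1 - x) * ln v) \<le> x * u + (1 - x) * v"
proof -
  consider "x = 0" | "x = 1" | "u > 0" "v > 0"
    using assms by fastforce
  then show ?thesis
  proof cases
    case 3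
    then show ?thesis
      using convex_onD[OF exp_convex, of "1 - x" "ln u" "ln v"] assms by simp
  qed (use assms in \<open>auto simp: le_less\<close>)
qed

text \<open>With \<open>x = a / m\<close>, the ratios \<open>u = q / x\<close> and
  \<open>v = (1 - q) / (1 - x)\<close> have \<open>x\<close>-weighted mean 1, so AM-GM gives
  \<open>u^a v^b \<le> 1\<close>: the empirical frequency maximizes the likelihood.\<close>

lemma bernoulli_likelihood_le:
  fixes q :: real
  assumes q: "0 \<le> q" "q \<le> 1" and m: "a + b = m" "m \<ge> 1"
  shows "q ^ a * (1 - q) ^ b \<le> real a ^ a * real b ^ b / real m ^ m"
proof (cases "a = 0 \<or> b = 0")
  case True
  then show ?thesis using assms by (auto intro!: power_le_one)
next
  case False
  show ?thesis
  proof (cases "q = 0 \<or> q = 1")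
    case True
    then show ?thesis using False by (auto simp: power_0_left)
  next
    case q01: False
    define x where "x = real a / real m"
    define u where "u = q / x"
    define v where "v = (1 - q) / (1 - x)"
    have x: "0 < x" "x < 1" and x': "1 - x = real b / real m"
      using False m by (auto simp: x_def field_simps simp flip: of_nat_add)
    have uv: "u > 0" "v > 0"
      using x q q01 by (auto simp: u_def v_def)
    have "exp (x * ln u + (1 - x) * ln v) \<le> x * u + (1 - x) * v"
      using x uv by (intro exp_weighted_ln_le) auto
    also have "\<dots> = 1" using x by (simp add: u_def v_def)
    finally have "x * ln u + (1 - x) * ln v \<le> 0" by simp
    then have "real m * (x * ln u + (1 - x) * ln v) \<le> 0"
      by (simp add: mult_nonneg_nonpos)
    also have "real m * (x * ln u + (1 - x) * ln v) = real a * ln u + real b * ln v"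
      unfolding x' using m by (simp add: x_def field_simps)
    finally have "exp (real a * ln u + real b * ln v) \<le> 1" by simp
    then have "u ^ a * v ^ b \<le> 1"
      using uv by (simp add: exp_add exp_of_nat_mult)
    then have "q ^ a * (1 - q) ^ b \<le> x ^ a * (1 - x) ^ b"
      using x by (simp add: u_def v_def power_divide field_simps)
    also have "\<dots> = real a ^ a * real b ^ b / real m ^ m"
      unfolding x' using m(1) by (auto simp: x_def power_divide power_add)
    finally show ?thesis .
  qed
qed

text \<open>The maximal likelihood is multiplied by a factor that is at least 1 by
  \<open>pochhammer_half_lower\<close>; this produces \<open>kt_half m\<close>, which
  submultiplicativity splits between \<open>a\<close> and \<open>b\<close>.\<close>

lemma likelihood_le_kt_prob:
  fixes q :: real
  assumes q: "0 \<le> q" "q \<le> 1" and m: "a + b = m" "m \<ge> 1"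
  shows "q ^ a * (1 - q) ^ b \<le> 2 * sqrt (real m) * kt_prob a b"
proof -
  have pos: "real a ^ a > 0" "real b ^ b > 0" "real m ^ m > 0"
    using m by auto
  have "q ^ a * (1 - q) ^ b \<le> real a ^ a * real b ^ b / real m ^ m"
    by (rule bernoulli_likelihood_le[OF assms])
  also have "\<dots> \<le> real a ^ a * real b ^ b / real m ^ m * (2 * sqrt (real m) * pochhammer (1/2) m / fact m)"
    using pochhammer_half_lower[OF m(2)] pos
    by (subst mult_le_cancel_left1) (auto simp: le_divide_eq divide_less_0_iff mult_less_0_iff)
  also have "\<dots> = 2 * sqrt (real m) / fact m * (real a ^ a * real b ^ b) * kt_half m"
    by (simp add: kt_half_def mult_ac)
  also have "\<dots> \<le> 2 * sqrt (real m) / fact m * (real a ^ a * real b ^ b) * (kt_half a * kt_half b)"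
    using kt_half_submult[of a b] m by (intro mult_left_mono) auto
  also have "\<dots> = 2 * sqrt (real m) * kt_prob a b"
    using pos m(1) by (simp add: kt_half_def kt_prob_def)
  finally show ?thesis .
qed

text \<open>Grouping by cardinality leaves Vandermonde's identity for rising factorials; since
  \<open>1/2 + 1/2 = 1\<close>, the numerator is \<open>pochhammer 1 m = m!\<close>.\<close>

lemma sum_kt_prob_subsets:
  "(\<Sum>A\<in>Pow {..<m}. kt_prob (card A) (m - card A)) = 1"
proof -
  have "(\<Sum>A\<in>Pow {..<m}. kt_prob (card A) (m - card A))
      = (\<Sum>k\<le>m. \<Sum>A\<in>{A\<in>Pow {..<m}. card A = k}. kt_prob (card A) (m - card A))"
    using card_mono[of "{..<m}"] by (intro sum.group[symmetric]) auto
  also have "\<dots> = (\<Sum>k\<le>m. real (m choose k) * kt_prob k (m - k))"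
    using n_subsets[of "{..<m}"] by (intro sum.cong) (auto simp: Pow_def)
  also have "\<dots> = (\<Sum>k\<le>m. real (m choose k) * pochhammer (1/2) k * pochhammer (1/2) (m - k)) / fact m"
    by (auto simp: sum_divide_distrib kt_prob_def intro!: sum.cong)
  also have "\<dots> = 1"
    by (simp flip: pochhammer_binomial_sum pochhammer_fact)
  finally show ?thesis .
qed

subsection \<open>The exponential moment of the binary divergence\<close>

text \<open>The expansion over subsets \<open>A\<close> replaces the integral over \<open>q\<close>. The quotients are taken in
  the extended nonnegative reals: for \<open>p = 0\<close> a positive loss makes the wealth infinite, while
  \<open>0 / 0 = 0\<close>, so that the expectation stays at most 1 for \<open>p\<close> equal to 0 or 1.\<close>

definition kt_wealth :: "nat \<Rightarrow> real \<Rightarrow> (nat \<Rightarrow> real) \<Rightarrow> ennreal" where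
  "kt_wealth m p x = (\<Sum>A\<in>Pow {..<m}. ennreal (kt_prob (card A) (m - card A)) *
     (\<Prod>j<m. if j \<in> A then ennreal (x j) / ennreal p else ennreal (1 - x j) / ennreal (1 - p)))"

definition real_kl :: "real \<Rightarrow> real \<Rightarrow> real" where
  "real_kl q p = q * ln (q / p) + (1 - q) * ln ((1 - q) / (1 - p))"

text \<open>The assumptions exclude exactly the infinite values of \<open>binkl\<close>, where \<open>real_kl\<close> is junk.\<close>

lemma binkl_eq_real_kl:
  assumes "p = 0 \<Longrightarrow> q = 0" "p = 1 \<Longrightarrow> q = 1"
  shows "binkl q p = ereal (real_kl q p)"
  using assms by (auto simp: binkl_def xlogxy_def real_kl_def)

lemma exp_kl_le_kt_wealth_interior:
  fixes x :: "nat \<Rightarrow> real"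
  assumes p: "0 < p" "p < 1" and m: "m \<ge> 1"
    and x: "\<And>j. j < m \<Longrightarrow> 0 \<le> x j \<and> x j \<le> 1"
    and q_def: "q = (\<Sum>j<m. x j) / real m"
  shows "ennreal (exp (real m * real_kl q p)) \<le> ennreal (2 * sqrt (real m)) * kt_wealth m p x"
proof -
  have sx: "(\<Sum>j<m. x j) = real m * q" "(\<Sum>j<m. 1 - x j) = real m * (1 - q)"
    using m by (simp_all add: q_def sum_subtractf field_simps)
  have sum_bd: "0 \<le> (\<Sum>j<m. x j)" "(\<Sum>j<m. x j) \<le> real m"
    using x sum_bounded_above[of "{..<m}" x 1] by (auto intro: sum_nonneg)
  then have q: "0 \<le> q" "q \<le> 1"
    using m by (auto simp: q_def)
  \<comment> \<open>If \<open>q\<close> is 0 or 1, one of \<open>q / p\<close> and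
    \<open>(1 - q) / (1 - p)\<close> vanishes; all losses then equal \<open>q\<close>, which gives
    that quotient weight 0, as \<open>exp_weighted_ln_le\<close> demands.\<close>
  have q0: "x j = 0" if "q = 0" "j < m" for j
    using sx(1) that sum_nonneg_eq_0_iff[of "{..<m}" x] x by auto
  have q1: "x j = 1" if "q = 1" "j < m" for j
    using sx(2) that sum_nonneg_eq_0_iff[of "{..<m}" "\<lambda>j. 1 - x j"] x by auto
  let ?u = "q / p" and ?v = "(1 - q) / (1 - p)"
  let ?c = "\<lambda>A j. if j \<in> A then x j / p else (1 - x j) / (1 - p)"
  have c_nonneg: "0 \<le> ?c A j" if "j < m" for A j
    using that x p by auto
  have "real m * real_kl q p = (\<Sum>j<m. x j * ln ?u + (1 - x j) * ln ?v)"
    unfolding sum.distrib by (simp add: real_kl_def sx distrib_left flip: sum_distrib_right)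
  then have "exp (real m * real_kl q p) = (\<Prod>j<m. exp (x j * ln ?u + (1 - x j) * ln ?v))"
    by (simp add: exp_sum)
  also have "\<dots> \<le> (\<Prod>j<m. x j * ?u + (1 - x j) * ?v)"
    using x p q q0 q1 by (intro prod_mono conjI exp_weighted_ln_le) auto
  \<comment> \<open>\<open>A\<close> collects the indices where the first summand is chosen. The
    powers of \<open>q\<close> and \<open>1 - q\<close> separate into the likelihood of a binary
    string with \<open>card A\<close> ones, which is then bounded by its KT probability.\<close>
  also have "\<dots> = (\<Sum>A\<in>Pow {..<m}. (\<Prod>j\<in>A. x j * ?u) * (\<Prod>j\<in>{..<m}-A. (1 - x j) * ?v))"
    by (rule prod_add) simp
  also have "\<dots> = (\<Sum>A\<in>Pow {..<m}. q ^ card A * (1 - q) ^ (m - card A) * (\<Prod>j<m. ?c A j))"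
  proof (rule sum.cong[OF refl])
    fix A assume A: "A \<in> Pow {..<m}"
    have "(\<Prod>j\<in>A. x j * ?u) = q ^ card A * (\<Prod>j\<in>A. x j / p)"
      by (simp add: prod.distrib prod_dividef power_divide)
    moreover have "(\<Prod>j\<in>{..<m}-A. (1 - x j) * ?v)
        = (1 - q) ^ (m - card A) * (\<Prod>j\<in>{..<m}-A. (1 - x j) / (1 - p))"
      using A by (simp add: prod.distrib prod_dividef power_divide card_Diff_subset finite_subset)
    moreover have "(\<Prod>j<m. ?c A j) = (\<Prod>j\<in>A. x j / p) * (\<Prod>j\<in>{..<m}-A. (1 - x j) / (1 - p))"
      using A by (subst prod.subset_diff[of A]) (auto intro!: arg_cong2[where f="(*)"] prod.cong)
    ultimately show "(\<Prod>j\<in>A. x j * ?u) * (\<Prod>j\<in>{..<m}-A. (1 - x j) * ?v)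
        = q ^ card A * (1 - q) ^ (m - card A) * (\<Prod>j<m. ?c A j)"
      by simp
  qed
  also have "\<dots> \<le> (\<Sum>A\<in>Pow {..<m}. 2 * sqrt (real m) * kt_prob (card A) (m - card A) * (\<Prod>j<m. ?c A j))"
  proof (intro sum_mono mult_right_mono likelihood_le_kt_prob q m)
    fix A assume "A \<in> Pow {..<m}"
    then show "card A + (m - card A) = m"
      using card_mono[of "{..<m}" A] by auto
    show "0 \<le> (\<Prod>j<m. ?c A j)"
      by (intro prod_nonneg) (use c_nonneg in auto)
  qed
  also have "\<dots> = 2 * sqrt (real m) * (\<Sum>A\<in>Pow {..<m}. kt_prob (card A) (m - card A) * (\<Prod>j<m. ?c A j))"
    by (simp add: sum_distrib_left mult.assoc)
  finally have *: "exp (real m * real_kl q p)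
      \<le> 2 * sqrt (real m) * (\<Sum>A\<in>Pow {..<m}. kt_prob (card A) (m - card A) * (\<Prod>j<m. ?c A j))" .
  have "kt_wealth m p x = (\<Sum>A\<in>Pow {..<m}. ennreal (kt_prob (card A) (m - card A)) * (\<Prod>j<m. ennreal (?c A j)))"
    unfolding kt_wealth_def using x p
    by (intro sum.cong arg_cong2[where f="(*)"] prod.cong refl) (auto simp: divide_ennreal)
  also have "\<dots> = (\<Sum>A\<in>Pow {..<m}. ennreal (kt_prob (card A) (m - card A) * (\<Prod>j<m. ?c A j)))"
  proof (intro sum.cong refl)
    fix A
    have "(\<Prod>j<m. ennreal (?c A j)) = ennreal (\<Prod>j<m. ?c A j)"
      by (rule prod_ennreal) (use c_nonneg in auto)
    then show "ennreal (kt_prob (card A) (m - card A)) * (\<Prod>j<m. ennreal (?c A j))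
        = ennreal (kt_prob (card A) (m - card A) * (\<Prod>j<m. ?c A j))"
      by (simp only: ennreal_mult'[OF less_imp_le[OF kt_prob_pos]])
  qed
  also have "\<dots> = ennreal (\<Sum>A\<in>Pow {..<m}. kt_prob (card A) (m - card A) * (\<Prod>j<m. ?c A j))"
    using kt_prob_pos c_nonneg by (intro sum_ennreal mult_nonneg_nonneg prod_nonneg) (auto simp: less_imp_le)
  finally have "ennreal (2 * sqrt (real m)) * kt_wealth m p x
      = ennreal (2 * sqrt (real m) * (\<Sum>A\<in>Pow {..<m}. kt_prob (card A) (m - card A) * (\<Prod>j<m. ?c A j)))"
    by (simp add: ennreal_mult')
  with * show ?thesis
    by (simp add: ennreal_leI)
qed

lemma kt_wealth_ge_term:
  assumes "A \<subseteq> {..<m}"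
  shows "ennreal (kt_prob (card A) (m - card A)) *
     (\<Prod>j<m. if j \<in> A then ennreal (x j) / ennreal p else ennreal (1 - x j) / ennreal (1 - p))
     \<le> kt_wealth m p x"
  unfolding kt_wealth_def by (rule member_le_sum) (use assms in auto)

text \<open>One constant string suffices: its factors are all 1, and its KT weight is at least
  \<open>1 / (2 sqrt m)\<close> by \<open>likelihood_le_kt_prob\<close> at bias 0 or 1.\<close>

lemma kt_wealth_degenerate_ge:
  assumes p: "p = 0 \<or> p = 1" and m: "m \<ge> 1" and x: "\<And>j. j < m \<Longrightarrow> x j = p"
  shows "1 \<le> ennreal (2 * sqrt (real m)) * kt_wealth m p x"
proof -
  define A where "A = (if p = 0 then {} else {..<m})"
  have A: "A \<subseteq> {..<m}" and card: "card A = 0 \<or> card A = m"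
    by (auto simp: A_def)
  have "(\<Prod>j<m. if j \<in> A then ennreal (x j) / ennreal p else ennreal (1 - x j) / ennreal (1 - p)) = 1"
    using p x by (intro prod.neutral) (auto simp: A_def)
  with kt_wealth_ge_term[OF A, of x p]
  have "ennreal (kt_prob (card A) (m - card A)) \<le> kt_wealth m p x"
    by simp
  then have "ennreal (2 * sqrt (real m)) * ennreal (kt_prob (card A) (m - card A))
      \<le> ennreal (2 * sqrt (real m)) * kt_wealth m p x"
    by (intro mult_left_mono) auto
  moreover have "1 \<le> 2 * sqrt (real m) * kt_prob (card A) (m - card A)"
    using likelihood_le_kt_prob[of 0 0 m m] likelihood_le_kt_prob[of 1 m 0 m] m card by auto
  then have "1 \<le> ennreal (2 * sqrt (real m)) * ennreal (kt_prob (card A) (m - card A))"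
    by (simp flip: ennreal_mult' add: kt_prob_pos)
  ultimately show ?thesis
    by (rule order.trans[rotated])
qed

lemma kt_wealth_degenerate_top:
  assumes p: "p = 0 \<or> p = 1" and x: "\<And>j. j < m \<Longrightarrow> 0 \<le> x j \<and> x j \<le> 1"
    and bad: "k < m" "x k \<noteq> p"
  shows "kt_wealth m p x = \<infinity>"
proof -
  \<comment> \<open>Chosen so that no factor vanishes while the factor at \<open>k\<close> divides a
    positive number by 0; a zero factor would spoil the product, since
    \<open>0 * \<infinity> = 0\<close>.\<close>
  define A where "A = {j. j < m \<and> (if p = 0 then x j \<noteq> 0 else x j = 1)}"
  let ?f = "\<lambda>j. if j \<in> A then ennreal (x j) / ennreal p else ennreal (1 - x j) / ennreal (1 - p)"
  have A: "A \<subseteq> {..<m}"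
    by (auto simp: A_def)
  have nz: "?f j \<noteq> 0" if "j < m" for j
    using p x[OF that] that
    by (auto simp: A_def ennreal_divide_eq_0_iff less_le)
  have top: "?f k = \<infinity>"
    using p x[OF bad(1)] bad by (auto simp: A_def ennreal_divide_eq_top_iff less_le)
  have "(\<Prod>j<m. ?f j) = \<infinity>"
    unfolding infinity_ennreal_def ennreal_prod_eq_top
    using nz top bad by (intro conjI bexI[of _ k]) auto
  with kt_wealth_ge_term[OF A, of x p] kt_prob_pos[of "card A" "m - card A"]
  show ?thesis
    by (simp add: ennreal_mult_top top_unique)
qed

text \<open>Almost sure finiteness of the wealth will exclude the first alternative; the second
  provides the conditions under which \<open>binkl\<close> is finite. At the endpoints the split is
  whether every loss equals \<open>p\<close>.\<close>

lemma kt_wealth_dichotomy: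
  fixes x :: "nat \<Rightarrow> real"
  assumes p: "0 \<le> p" "p \<le> 1" and m: "m \<ge> 1"
    and x: "\<And>j. j < m \<Longrightarrow> 0 \<le> x j \<and> x j \<le> 1"
    and q_def: "q = (\<Sum>j<m. x j) / real m"
  shows "kt_wealth m p x = \<infinity> \<or>
    ((p = 0 \<longrightarrow> q = 0) \<and> (p = 1 \<longrightarrow> q = 1) \<and>
     ennreal (exp (real m * real_kl q p)) \<le> ennreal (2 * sqrt (real m)) * kt_wealth m p x)"
proof (cases "p = 0 \<or> p = 1")
  case True
  show ?thesis
  proof (cases "\<forall>j<m. x j = p")
    case eq: True
    then have "q = p"
      using m by (simp add: q_def)
    then show ?thesis
      using kt_wealth_degenerate_ge[OF True m, of x] True eq by (auto simp: real_kl_def)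
  next
    case False
    then show ?thesis
      using kt_wealth_degenerate_top[where m = m and x = x, OF True x] by blast
  qed
next
  case False
  then show ?thesis
    using exp_kl_le_kt_wealth_interior[OF _ _ m x q_def] p by auto
qed

subsection \<open>Product measures, joint prior and joint posterior\<close>

lemma nn_integral_PiM_prod:
  assumes I: "finite I" and M: "\<And>i. i \<in> I \<Longrightarrow> prob_space (M i)"
    and f: "\<And>i. i \<in> I \<Longrightarrow> f i \<in> borel_measurable (M i)"
  shows "(\<integral>\<^sup>+x. (\<Prod>i\<in>I. f i (x i)) \<partial>Pi\<^sub>M I M) = (\<Prod>i\<in>I. \<integral>\<^sup>+x. f i x \<partial>M i)"
proof -
  \<comment> \<open>The locale asks for sigma-finiteness at every index, so the family is extended
    by a trivial measure outside \<open>I\<close>.\<close>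
  define N where "N i = (if i \<in> I then M i else count_space {})" for i
  interpret product_sigma_finite N
  proof (rule product_sigma_finite.intro)
    show "sigma_finite_measure (N i)" for i
      by (cases "i \<in> I")
        (simp_all add: N_def M prob_space_imp_sigma_finite sigma_finite_measure_count_space_finite)
  qed
  have "Pi\<^sub>M I M = Pi\<^sub>M I N"
    by (rule PiM_cong) (auto simp: N_def)
  then have "(\<integral>\<^sup>+x. (\<Prod>i\<in>I. f i (x i)) \<partial>Pi\<^sub>M I M) = (\<Prod>i\<in>I. integral\<^sup>N (N i) (f i))"
    using product_nn_integral_prod[OF I, of f] f by (simp add: N_def)
  then show ?thesis
    by (simp add: N_def)
qed

text \<open>Makes \<open>joint_prior\<close> a bind along a probability kernel. Boxes form an
  intersection-stable generator, and on them the measure is a finite product of measurable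
  evaluations of \<open>P\<close>.\<close>

lemma measurable_PiM_prob_algebra:
  assumes I: "finite I"
  shows "(\<lambda>P. \<Pi>\<^sub>M i\<in>I. P) \<in> prob_algebra M \<rightarrow>\<^sub>M prob_algebra (\<Pi>\<^sub>M i\<in>I. M)"
proof (rule measurable_prob_algebra_generated[OF sets_PiM Int_stable_prod_algebra prod_algebra_sets_into_space])
  fix P assume "P \<in> space (prob_algebra M)"
  then show "prob_space (\<Pi>\<^sub>M i\<in>I. P)" "sets (\<Pi>\<^sub>M i\<in>I. P) = sets (\<Pi>\<^sub>M i\<in>I. M)"
    by (auto simp: space_prob_algebra intro!: prob_space_PiM sets_PiM_cong)
next
  fix A assume "A \<in> prod_algebra I (\<lambda>_. M)"
  then obtain E where A: "A = Pi\<^sub>E I E" and E: "E \<in> (\<Pi> i\<in>I. sets M)"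
    by (rule prod_algebraE_all)
  have "emeasure (\<Pi>\<^sub>M i\<in>I. P) A = (\<Prod>i\<in>I. emeasure P (E i))" if "P \<in> space (prob_algebra M)" for P
  proof -
    from that have P: "sets P = sets M" "prob_space P"
      by (auto simp: space_prob_algebra)
    interpret P: prob_space P by (rule P)
    interpret product_sigma_finite "\<lambda>_. P" by standard
    show ?thesis
      unfolding A using I E P by (intro emeasure_PiM) auto
  qed
  moreover have "(\<lambda>P. \<Prod>i\<in>I. emeasure P (E i)) \<in> borel_measurable (prob_algebra M)"
  proof (rule borel_measurable_prod_ennreal)
    fix i assume "i \<in> I"
    then show "(\<lambda>P. emeasure P (E i)) \<in> borel_measurable (prob_algebra M)"
      using E unfolding prob_algebra_def by (intro measurable_restrict_space1 measurable_emeasure_subprob_algebra) auto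
  qed
  ultimately show "(\<lambda>P. emeasure (\<Pi>\<^sub>M i\<in>I. P) A) \<in> borel_measurable (prob_algebra M)"
    by (subst measurable_cong) auto
qed

lemma
  assumes "hP \<in> space (prob_algebra (prob_algebra MF))"
  shows prob_space_joint_prior: "prob_space (joint_prior MF n hP)"
    and sets_joint_prior: "sets (joint_prior MF n hP) = sets (prob_algebra MF \<Otimes>\<^sub>M (\<Pi>\<^sub>M i\<in>{..<n}. MF))"
proof -
  have "(\<lambda>P. distr (\<Pi>\<^sub>M i\<in>{..<n}. P) (prob_algebra MF \<Otimes>\<^sub>M (\<Pi>\<^sub>M i\<in>{..<n}. MF)) (\<lambda>fs. (P, fs)))
      \<in> prob_algebra MF \<rightarrow>\<^sub>M prob_algebra (prob_algebra MF \<Otimes>\<^sub>M (\<Pi>\<^sub>M i\<in>{..<n}. MF))"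
    by (rule measurable_distr_prob_space2[OF measurable_PiM_prob_algebra]) auto
  from prob_space_bind'[OF assms this] sets_bind'[OF assms this]
  show "prob_space (joint_prior MF n hP)"
    "sets (joint_prior MF n hP) = sets (prob_algebra MF \<Otimes>\<^sub>M (\<Pi>\<^sub>M i\<in>{..<n}. MF))"
    by (auto simp: joint_prior_def)
qed

text \<open>The marginals serve to move integrals and null sets between a single posterior and the
  joint posterior.\<close>

lemma
  assumes hQ: "hQ \<in> space (prob_algebra (prob_algebra MF))"
    and Qs: "\<And>i. i < n \<Longrightarrow> Qs i \<in> space (prob_algebra MF)"
  shows prob_space_joint_post: "prob_space (joint_post MF n hQ Qs)"
    and sets_joint_post: "sets (joint_post MF n hQ Qs) = sets (prob_algebra MF \<Otimes>\<^sub>M (\<Pi>\<^sub>M i\<in>{..<n}. MF))"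
    and distr_joint_post: "i < n \<Longrightarrow> distr (joint_post MF n hQ Qs) (Qs i) (\<lambda>\<omega>. snd \<omega> i) = Qs i"
proof -
  have hQ': "sets hQ = sets (prob_algebra MF)" "prob_space hQ"
    and Qs': "\<And>i. i < n \<Longrightarrow> sets (Qs i) = sets MF" "\<And>i. i < n \<Longrightarrow> prob_space (Qs i)"
    using hQ Qs by (auto simp: space_prob_algebra)
  have prod: "prob_space (Pi\<^sub>M {..<n} Qs)"
    using Qs' by (auto intro: prob_space_PiM)
  show "prob_space (joint_post MF n hQ Qs)"
    unfolding joint_post_def by (rule prob_space_pair[OF hQ'(2) prod])
  show "sets (joint_post MF n hQ Qs) = sets (prob_algebra MF \<Otimes>\<^sub>M (\<Pi>\<^sub>M i\<in>{..<n}. MF))"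
    unfolding joint_post_def using hQ' Qs' by (intro sets_pair_measure_cong sets_PiM_cong) auto
  show "distr (joint_post MF n hQ Qs) (Qs i) (\<lambda>\<omega>. snd \<omega> i) = Qs i" if i: "i < n"
  proof -
    interpret hQ: prob_space hQ by (rule hQ')
    interpret PQ: prob_space "Pi\<^sub>M {..<n} Qs" by (rule prod)
    have snd: "distr (hQ \<Otimes>\<^sub>M Pi\<^sub>M {..<n} Qs) (Pi\<^sub>M {..<n} Qs) snd = Pi\<^sub>M {..<n} Qs"
    proof (rule measure_eqI)
      fix A assume "A \<in> sets (distr (hQ \<Otimes>\<^sub>M Pi\<^sub>M {..<n} Qs) (Pi\<^sub>M {..<n} Qs) snd)"
      then have A: "A \<in> sets (Pi\<^sub>M {..<n} Qs)" by simp
      then have "snd -` A \<inter> space (hQ \<Otimes>\<^sub>M Pi\<^sub>M {..<n} Qs) = space hQ \<times> A"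
        by (auto simp: space_pair_measure dest: sets.sets_into_space)
      with A show "emeasure (distr (hQ \<Otimes>\<^sub>M Pi\<^sub>M {..<n} Qs) (Pi\<^sub>M {..<n} Qs) snd) A = emeasure (Pi\<^sub>M {..<n} Qs) A"
        by (simp add: emeasure_distr PQ.emeasure_pair_measure_Times hQ.emeasure_space_1)
    qed simp
    have "distr (distr (hQ \<Otimes>\<^sub>M Pi\<^sub>M {..<n} Qs) (Pi\<^sub>M {..<n} Qs) snd) (Qs i) (\<lambda>x. x i) = Qs i"
      unfolding snd using i Qs'(2) by (intro distr_PiM_component) auto
    then show ?thesis
      using i by (simp add: distr_distr joint_post_def comp_def)
  qed
qed

subsection \<open>Change of measure\<close>

text \<open>With \<open>\<rho>\<close> the density of \<open>N\<close>, the quotient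
  \<open>V / \<rho>\<close> has \<open>N\<close>-mean at most \<open>C\<close> and dominates
  \<open>exp (\<phi> - ln \<rho>)\<close>. The majorant \<open>V\<close> of
  \<open>exp \<phi>\<close> may be infinite and is compared only \<open>N\<close>-almost
  everywhere.\<close>

lemma donsker_varadhan:
  assumes "prob_space M" "prob_space N" and sets_eq: "sets N = sets M"
    and ac: "absolutely_continuous M N"
    and int: "integrable N (entropy_density (exp 1) M N)"
    and \<phi>: "integrable N \<phi>"
    and V[measurable]: "V \<in> borel_measurable M"
    and C: "(\<integral>\<^sup>+x. V x \<partial>M) \<le> ennreal C" "C > 0"
    and le: "AE x in N. ennreal (exp (\<phi> x)) \<le> V x"
  shows "(\<integral>x. \<phi> x \<partial>N) \<le> KL_divergence (exp 1) M N + ln C"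
proof -
  interpret M: prob_space M by fact
  interpret N: prob_space N by fact
  note sets_eq[measurable_cong, simp]
  define \<rho> where "\<rho> = RN_deriv M N"
  have [measurable]: "\<rho> \<in> borel_measurable M"
    by (simp add: \<rho>_def)
  have N: "N = density M \<rho>"
    using M.density_RN_deriv[OF ac sets_eq] by (simp add: \<rho>_def)
  have "AE x in M. \<rho> x \<noteq> \<infinity>"
    unfolding \<rho>_def by (rule M.RN_deriv_finite[OF _ ac sets_eq]) (rule N.sigma_finite_measure_axioms)
  then have fin: "AE x in N. \<rho> x \<noteq> \<infinity>"
    using absolutely_continuous_AE[OF sets_eq ac] by simp
  have pos: "AE x in N. \<rho> x \<noteq> 0"
    unfolding N by (subst AE_density) auto
  have "(\<integral>\<^sup>+x. V x / \<rho> x \<partial>N) = (\<integral>\<^sup>+x. \<rho> x * (V x / \<rho> x) \<partial>M)"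
    unfolding N by (rule nn_integral_density) auto
  \<comment> \<open>Where \<open>\<rho> = 0\<close> the left integrand is 0 whatever
    \<open>V\<close> is, hence only an inequality.\<close>
  also have "\<dots> \<le> (\<integral>\<^sup>+x. V x \<partial>M)"
    using \<open>AE x in M. \<rho> x \<noteq> \<infinity>\<close>
  proof (intro nn_integral_mono_AE, eventually_elim)
    case (elim x)
    then show ?case
      by (cases "\<rho> x = 0") (auto simp: ennreal_times_divide mult.commute[of "\<rho> x"] mult_divide_eq_ennreal)
  qed
  finally have Vr: "(\<integral>\<^sup>+x. V x / \<rho> x \<partial>N) \<le> ennreal C"
    using C by order
  let ?e = "entropy_density (exp 1) M N"
  let ?g = "\<lambda>x. exp (\<phi> x - ?e x)"
  have g_le: "AE x in N. ennreal (?g x) \<le> V x / \<rho> x"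
    using le fin pos
  proof eventually_elim
    case (elim x)
    define r where "r = enn2real (\<rho> x)"
    have r: "\<rho> x = ennreal r" "r > 0"
      using elim by (auto simp: r_def less_top enn2real_positive_iff zero_less_iff_neq_zero)
    have "exp (?e x) = r"
      using r by (simp add: entropy_density_def log_def r_def \<rho>_def)
    then have "ennreal (?g x) = ennreal (exp (\<phi> x)) / \<rho> x"
      using r by (simp add: exp_diff divide_ennreal)
    also have "\<dots> \<le> V x / \<rho> x"
      using elim by (intro divide_right_mono_ennreal)
    finally show ?case .
  qed
  have [measurable]: "\<phi> \<in> borel_measurable N" "?e \<in> borel_measurable N"
    using \<phi> int by auto
  have g_nn: "(\<integral>\<^sup>+x. ennreal (?g x) \<partial>N) \<le> ennreal C"
    using nn_integral_mono_AE[OF g_le] Vr by order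
  then have g_int: "integrable N ?g"
    by (intro integrableI_bounded) (auto simp: less_top[symmetric] top_unique)
  have g_le_C: "(\<integral>x. ?g x \<partial>N) \<le> C"
    using g_nn nn_integral_eq_integral[OF g_int] C(2) by simp
  \<comment> \<open>Jensen for the logarithm in the pointwise form \<open>1 + t \<le> exp t\<close>;
    normalizing by \<open>C\<close> makes the integral on the right nonpositive.\<close>
  have "(\<integral>x. \<phi> x - ?e x - ln C \<partial>N) \<le> (\<integral>x. ?g x / C - 1 \<partial>N)"
  proof (rule integral_mono)
    fix x
    have "1 + (\<phi> x - ?e x - ln C) \<le> exp (\<phi> x - ?e x - ln C)"
      by (rule exp_ge_add_one_self)
    also have "\<dots> = ?g x / C"
      using C(2) by (simp add: exp_diff)
    finally show "\<phi> x - ?e x - ln C \<le> ?g x / C - 1"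
      by simp
  qed (use \<phi> int g_int in auto)
  also have "\<dots> = (\<integral>x. ?g x \<partial>N) / C - 1"
    using g_int by (simp add: N.prob_space)
  also have "\<dots> \<le> 0"
    using g_le_C C(2) by simp
  finally have "(\<integral>x. \<phi> x \<partial>N) - (\<integral>x. ?e x \<partial>N) - ln C \<le> 0"
    using \<phi> int by (simp add: N.prob_space)
  then show ?thesis
    by (simp add: KL_divergence_def)
qed

subsection \<open>Expected wealth and tangents of the divergence\<close>

lemma measurable_kt_wealth[measurable (raw)]:
  assumes [measurable]: "p \<in> borel_measurable M" "\<And>j. j < m \<Longrightarrow> (\<lambda>\<omega>. x \<omega> j) \<in> borel_measurable M"
  shows "(\<lambda>\<omega>. kt_wealth m (p \<omega>) (x \<omega>)) \<in> borel_measurable M"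
proof -
  have "(\<lambda>\<omega>. if j \<in> A then ennreal (x \<omega> j) / ennreal (p \<omega>) else ennreal (1 - x \<omega> j) / ennreal (1 - p \<omega>))
      \<in> borel_measurable M" if "j < m" for A j
    using that by measurable
  then show ?thesis
    unfolding kt_wealth_def
    by (intro borel_measurable_sum borel_measurable_times_ennreal borel_measurable_prod_ennreal
      borel_measurable_const) auto
qed

text \<open>Independence factors each product. A factor integrates to \<open>p / p\<close> or
  \<open>(1 - p) / (1 - p)\<close>, which is 1, or 0 when the denominator is 0; the KT weights sum
  to 1.\<close>

lemma nn_integral_kt_wealth_le_1:
  assumes "prob_space D" and g[measurable]: "g \<in> borel_measurable D"
    and g01: "\<And>z. 0 \<le> g z \<and> g z \<le> 1"
  shows "(\<integral>\<^sup>+s. kt_wealth m (\<integral>z. g z \<partial>D) (\<lambda>j. g (s j)) \<partial>(\<Pi>\<^sub>M j\<in>{..<m}. D)) \<le> 1"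
proof -
  interpret D: prob_space D by fact
  have g_int: "integrable D g"
    by (rule D.integrable_const_bound[where B=1]) (use g01 in auto)
  let ?p = "\<integral>z. g z \<partial>D"
  let ?c = "\<lambda>A j z. if j \<in> A then ennreal (g z) / ennreal ?p else ennreal (1 - g z) / ennreal (1 - ?p)"
  have self: "ennreal a / ennreal a \<le> 1" for a
    by (cases "ennreal a = 0") (auto simp: ennreal_divide_self)
  have c_le: "(\<integral>\<^sup>+z. ?c A j z \<partial>D) \<le> 1" for A j
  proof (cases "j \<in> A")
    case True
    then have "(\<integral>\<^sup>+z. ?c A j z \<partial>D) = ennreal ?p / ennreal ?p"
      using g01 g_int by (simp add: nn_integral_divide nn_integral_eq_integral)
    then show ?thesis using self by simp
  next
    case False
    have "(\<integral>\<^sup>+z. ennreal (1 - g z) \<partial>D) = ennreal (\<integral>z. 1 - g z \<partial>D)"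
      using g01 g_int by (intro nn_integral_eq_integral) auto
    then have "(\<integral>\<^sup>+z. ?c A j z \<partial>D) = ennreal (1 - ?p) / ennreal (1 - ?p)"
      using False g_int by (simp add: nn_integral_divide D.prob_space)
    then show ?thesis using self by simp
  qed
  have [measurable]: "?c A j \<in> borel_measurable D" for A j
    by measurable
  have [measurable]: "(\<lambda>s. \<Prod>j<m. ?c A j (s j)) \<in> borel_measurable (\<Pi>\<^sub>M j\<in>{..<m}. D)" for A
    by (intro borel_measurable_prod_ennreal measurable_PiM_component_rev) auto
  have "(\<integral>\<^sup>+s. kt_wealth m ?p (\<lambda>j. g (s j)) \<partial>(\<Pi>\<^sub>M j\<in>{..<m}. D))
      = (\<Sum>A\<in>Pow {..<m}. ennreal (kt_prob (card A) (m - card A)) *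
          (\<integral>\<^sup>+s. (\<Prod>j<m. ?c A j (s j)) \<partial>(\<Pi>\<^sub>M j\<in>{..<m}. D)))"
    unfolding kt_wealth_def by (simp add: nn_integral_sum nn_integral_cmult)
  also have "\<dots> = (\<Sum>A\<in>Pow {..<m}. ennreal (kt_prob (card A) (m - card A)) *
          (\<Prod>j<m. \<integral>\<^sup>+z. ?c A j z \<partial>D))"
    by (subst nn_integral_PiM_prod) (auto simp: D.prob_space_axioms)
  also have "\<dots> \<le> (\<Sum>A\<in>Pow {..<m}. ennreal (kt_prob (card A) (m - card A)) * 1)"
    by (intro sum_mono mult_left_mono prod_le_1) (use c_le in auto)
  also have "\<dots> = 1"
    using kt_prob_pos by (simp add: sum_ennreal less_imp_le sum_kt_prob_subsets)
  finally show ?thesis .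
qed

text \<open>This is \<open>ln t \<le> t - 1\<close> at \<open>t = y a / (b x)\<close>, multiplied by
  \<open>x\<close>. The left side is the tangent plane of \<open>x ln (x / y)\<close> at
  \<open>(a, b)\<close>, without constant term by homogeneity.\<close>

lemma xlog_tangent_le:
  fixes x y a b :: real
  assumes "0 \<le> x" "0 \<le> y" "0 \<le> a" "0 \<le> b"
    and "y = 0 \<Longrightarrow> x = 0" "a = 0 \<Longrightarrow> x = 0" "b = 0 \<Longrightarrow> x = 0"
  shows "x * ln (a / b) + x - y * (a / b) \<le> x * ln (x / y)"
proof (cases "x = 0")
  case True
  then show ?thesis using assms by simp
next
  case False
  then have pos: "x > 0" "y > 0" "a > 0" "b > 0"
    using assms by (auto simp: le_less)
  have "ln (y * a / (b * x)) \<le> y * a / (b * x) - 1"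
    using pos by (intro ln_le_minus_one) auto
  then have "x * ln (y * a / (b * x)) \<le> x * (y * a / (b * x) - 1)"
    using pos by (intro mult_left_mono) auto
  also have "\<dots> = y * (a / b) - x"
    using pos by (simp add: field_simps)
  finally show ?thesis
    using pos by (simp add: ln_div ln_mult algebra_simps)
qed

text \<open>An affine function of \<open>x f\<close> and \<open>y f\<close> is integrable and
  integrates exactly to its value at the means, while \<open>real_kl (x f) (y f)\<close> may fail to
  be integrable. Convexity puts the tangent plane below it.\<close>

lemma kl_tangent:
  assumes "prob_space Q" and [measurable]: "x \<in> borel_measurable Q" "y \<in> borel_measurable Q"
    and x01: "\<And>f. 0 \<le> x f \<and> x f \<le> 1" and y01: "\<And>f. 0 \<le> y f \<and> y f \<le> 1"
    and good: "AE f in Q. (y f = 0 \<longrightarrow> x f = 0) \<and> (y f = 1 \<longrightarrow> x f = 1)"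
    and a_def: "a = (\<integral>f. x f \<partial>Q)" and b_def: "b = (\<integral>f. y f \<partial>Q)"
  obtains T where "integrable Q T" "(\<integral>f. T f \<partial>Q) = real_kl a b"
    "AE f in Q. T f \<le> real_kl (x f) (y f)" "b = 0 \<Longrightarrow> a = 0" "b = 1 \<Longrightarrow> a = 1"
proof -
  interpret Q: prob_space Q by fact
  have ix: "integrable Q x" and iy: "integrable Q y"
    by (rule Q.integrable_const_bound[where B=1]; use x01 y01 in auto)+
  have zero: "AE f in Q. h f = 0" if "integrable Q h" "\<And>f. 0 \<le> h f" "(\<integral>f. h f \<partial>Q) = 0" for h :: "_ \<Rightarrow> real"
    using integral_nonneg_eq_0_iff_AE[OF that(1)] that by simp
  have cx: "(\<integral>f. 1 - x f \<partial>Q) = 1 - a" and cy: "(\<integral>f. 1 - y f \<partial>Q) = 1 - b"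
    using ix iy by (simp_all add: a_def b_def Q.prob_space)
  have a01: "0 \<le> a" "a \<le> 1" and b01: "0 \<le> b" "b \<le> 1"
    unfolding a_def b_def using x01 y01 ix iy
    by (auto intro!: integral_nonneg Q.integral_le_const)
  have a0: "AE f in Q. x f = 0" if "a = 0"
    using zero[OF ix] x01 that a_def by simp
  have a1: "AE f in Q. x f = 1" if "a = 1"
    using zero[of "\<lambda>f. 1 - x f"] x01 that cx ix by simp
  have b0: "AE f in Q. x f = 0" if "b = 0"
  proof -
    have "AE f in Q. y f = 0"
      using zero[OF iy] y01 that b_def by simp
    with good show ?thesis by eventually_elim auto
  qed
  have b1: "AE f in Q. x f = 1" if "b = 1"
  proof -
    have "AE f in Q. y f = 1"
      using zero[of "\<lambda>f. 1 - y f"] y01 that cy iy by simp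
    with good show ?thesis by eventually_elim auto
  qed
  have b0': "a = 0" if "b = 0"
    unfolding a_def using integral_cong_AE[of x Q "\<lambda>_. 0"] b0[OF that] by simp
  have b1': "a = 1" if "b = 1"
    unfolding a_def using integral_cong_AE[of x Q "\<lambda>_. 1"] b1[OF that] by (simp add: Q.prob_space)
  define T where "T f = (x f * ln (a / b) + x f - y f * (a / b))
      + ((1 - x f) * ln ((1 - a) / (1 - b)) + (1 - x f) - (1 - y f) * ((1 - a) / (1 - b)))" for f
  have T_int: "integrable Q T"
    unfolding T_def using ix iy
    by (intro Bochner_Integration.integrable_add Bochner_Integration.integrable_diff
      integrable_mult_left Q.integrable_const)
  have "(\<integral>f. T f \<partial>Q) = (a * ln (a / b) + a - b * (a / b))
      + ((1 - a) * ln ((1 - a) / (1 - b)) + (1 - a) - (1 - b) * ((1 - a) / (1 - b)))"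
    unfolding T_def using ix iy by (simp add: cx cy Q.prob_space flip: a_def b_def)
  \<comment> \<open>\<open>a - b * (a / b)\<close> vanishes also for \<open>b = 0\<close>, where the
    quotient is 0, because then \<open>a = 0\<close>; likewise for \<open>b = 1\<close> in the
    second part.\<close>
  also have "\<dots> = real_kl a b"
    using b0' b1' by (auto simp: real_kl_def)
  finally have T_eq: "(\<integral>f. T f \<partial>Q) = real_kl a b" .
  have conds: "AE f in Q. (a = 0 \<longrightarrow> x f = 0) \<and> (a = 1 \<longrightarrow> x f = 1) \<and> (b = 0 \<longrightarrow> x f = 0) \<and> (b = 1 \<longrightarrow> x f = 1)"
    using a0 a1 b0 b1 by (simp add: AE_conj_iff)
  have "AE f in Q. T f \<le> real_kl (x f) (y f)"
    using good conds
  proof eventually_elim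
    case (elim f)
    show ?case
      unfolding T_def real_kl_def
      by (intro add_mono xlog_tangent_le) (use elim x01[of f] y01[of f] a01 b01 in auto)
  qed
  from that[OF T_int T_eq this b0' b1'] show thesis .
qed

subsection \<open>Risks of a posterior\<close>

lemma integrable_loss_post:
  fixes l :: "'f \<Rightarrow> 'z \<Rightarrow> real"
  assumes Q: "Q \<in> space (prob_algebra MF)"
    and l[measurable]: "(\<lambda>(f, z). l f z) \<in> borel_measurable (MF \<Otimes>\<^sub>M MZ)"
    and l01: "\<And>f z. 0 \<le> l f z \<and> l f z \<le> 1"
    and z[measurable]: "z \<in> space MZ"
  shows "integrable Q (\<lambda>f. l f z)"
proof -
  have sQ[measurable_cong]: "sets Q = sets MF" and pQ: "prob_space Q"
    using Q by (auto simp: space_prob_algebra)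
  interpret prob_space Q by (rule pQ)
  show ?thesis
    by (rule integrable_const_bound[where B=1]) (use l01 in auto)
qed

lemma emp_risk_eq_integral:
  fixes l :: "'f \<Rightarrow> 'z \<Rightarrow> real"
  assumes Q: "Q \<in> space (prob_algebra MF)"
    and l: "(\<lambda>(f, z). l f z) \<in> borel_measurable (MF \<Otimes>\<^sub>M MZ)"
    and l01: "\<And>f z. 0 \<le> l f z \<and> l f z \<le> 1"
    and s: "\<And>j. j < m \<Longrightarrow> s j \<in> space MZ"
  shows "emp_risk l m s Q = (\<integral>f. (\<Sum>j<m. l f (s j)) / real m \<partial>Q)"
  using integrable_loss_post[OF Q l l01 s]
  by (simp add: emp_risk_def loss_post_def)

lemma true_risk_eq_integral:
  fixes l :: "'f \<Rightarrow> 'z \<Rightarrow> real"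
  assumes Q: "Q \<in> space (prob_algebra MF)" and D: "D \<in> space (prob_algebra MZ)"
    and l[measurable]: "(\<lambda>(f, z). l f z) \<in> borel_measurable (MF \<Otimes>\<^sub>M MZ)"
    and l01: "\<And>f z. 0 \<le> l f z \<and> l f z \<le> 1"
  shows "true_risk l D Q = (\<integral>f. (\<integral>z. l f z \<partial>D) \<partial>Q)"
proof -
  have sQ[measurable_cong]: "sets Q = sets MF" and sD[measurable_cong]: "sets D = sets MZ"
    and "prob_space Q" "prob_space D"
    using Q D by (auto simp: space_prob_algebra)
  interpret Q: prob_space Q by fact
  interpret D: prob_space D by fact
  interpret pair_prob_space Q D by standard
  have "integrable (Q \<Otimes>\<^sub>M D) (\<lambda>(f, z). l f z)"
    by (rule P.integrable_const_bound[where B=1]) (use l01 in \<open>auto simp: split_beta\<close>)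
  then show ?thesis
    unfolding true_risk_def loss_post_def by (rule Fubini_integral)
qed

lemma emp_mean_bounds:
  fixes x :: "nat \<Rightarrow> real"
  assumes "\<And>j. 0 \<le> x j \<and> x j \<le> 1" "m \<ge> 1"
  shows "0 \<le> (\<Sum>j<m. x j) / real m \<and> (\<Sum>j<m. x j) / real m \<le> 1"
  using assms sum_bounded_above[of "{..<m}" x 1] by (auto intro!: divide_nonneg_nonneg sum_nonneg)

subsection \<open>The PAC-Bayes bound\<close>

theorem theorem4:
  fixes MF :: "'f measure" and MZ :: "'z measure"
    and n :: nat and m :: "nat \<Rightarrow> nat"
    and D :: "nat \<Rightarrow> 'z measure"
    and l :: "nat \<Rightarrow> 'f \<Rightarrow> 'z \<Rightarrow> real"
    and hP :: "'f measure measure" and \<delta> :: real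
  assumes m_pos: "\<And>i. i < n \<Longrightarrow> m i \<ge> 1"
    and D_prob: "\<And>i. i < n \<Longrightarrow> D i \<in> space (prob_algebra MZ)"
    and l_meas: "\<And>i. i < n \<Longrightarrow> (\<lambda>(f, z). l i f z) \<in> borel_measurable (MF \<Otimes>\<^sub>M MZ)"
    and l_range: "\<And>i f z. i < n \<Longrightarrow> 0 \<le> l i f z \<and> l i f z \<le> 1"
    and hP_prob: "hP \<in> space (prob_algebra (prob_algebra MF))"
    and \<delta>_pos: "\<delta> > 0"
  shows "\<exists>E \<in> sets (sample_space n m D).
           measure (sample_space n m D) E \<ge> 1 - \<delta> \<and>
           (\<forall>S \<in> E. \<forall>hQ Qs.
              hQ \<in> space (prob_algebra (prob_algebra MF)) \<longrightarrow>
              (\<forall>i<n. Qs i \<in> space (prob_algebra MF)) \<longrightarrow>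
              (\<Sum>i<n. ereal (real (m i)) *
                   binkl (emp_risk (l i) (m i) (S i) (Qs i)) (true_risk (l i) (D i) (Qs i)))
              \<le> KL_ext (joint_post MF n hQ Qs) (joint_prior MF n hP)
                 + ereal (ln (1 / \<delta>) + (\<Sum>i<n. ln (2 * sqrt (real (m i))))))"
proof -
  have D_sets: "sets (D i) = sets MZ" and D_prob_space: "prob_space (D i)" if "i < n" for i
    using D_prob[OF that] by (auto simp: space_prob_algebra)
  have loss_meas: "(\<lambda>\<omega>. l i (g \<omega>) (h \<omega>)) \<in> borel_measurable K"
    if "i < n" "g \<in> K \<rightarrow>\<^sub>M MF" "h \<in> K \<rightarrow>\<^sub>M MZ" for i g h and K :: "'k measure"
    using measurable_compose[OF measurable_Pair[OF that(2,3)] l_meas[OF that(1)]] by simp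
  let ?SS = "sample_space n m D"
  let ?M = "joint_prior MF n hP"
  define p where "p i f = (\<integral>z. l i f z \<partial>D i)" for i f
  \<comment> \<open>Each factor is scaled so as to dominate \<open>exp (m i * kl)\<close>;
    \<open>C\<close> below bounds the resulting expectation.\<close>
  define V where "V S \<omega> = (\<Prod>i<n. ennreal (2 * sqrt (real (m i))) *
      kt_wealth (m i) (p i (snd \<omega> i)) (\<lambda>j. l i (snd \<omega> i) (S i j)))"
    for S and \<omega> :: "'f measure \<times> (nat \<Rightarrow> 'f)"
  define C where "C = (\<Prod>i<n. 2 * sqrt (real (m i)))"
  have C_pos: "C > 0"
    unfolding C_def by (intro prod_pos) (use m_pos in \<open>auto simp: Suc_le_eq\<close>)

  \<comment> \<open>Measurability and expectation of the joint wealth\<close>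
  interpret M: prob_space ?M
    by (rule prob_space_joint_prior[OF hP_prob])
  note M_sets = sets_joint_prior[OF hP_prob, of n]
  have row_prob: "prob_space (\<Pi>\<^sub>M j\<in>{..<m i}. D i)" if "i < n" for i
    using D_prob_space[OF that] by (intro prob_space_PiM)
  interpret SS: prob_space ?SS
    unfolding sample_space_def by (rule prob_space_PiM) (use row_prob in auto)
  have SS_sets: "sets ?SS = sets (\<Pi>\<^sub>M i\<in>{..<n}. \<Pi>\<^sub>M j\<in>{..<m i}. MZ)"
    unfolding sample_space_def by (intro sets_PiM_cong refl) (auto simp: D_sets)

  have p_meas: "p i \<in> borel_measurable MF" if i: "i < n" for i
  proof -
    interpret prob_space "D i" by (rule D_prob_space[OF i])
    have "(\<lambda>(f, z). l i f z) \<in> borel_measurable (MF \<Otimes>\<^sub>M D i)"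
      using l_meas[OF i] D_sets[OF i] by (simp cong: measurable_cong_sets)
    then show ?thesis
      unfolding p_def by (rule borel_measurable_lebesgue_integral)
  qed
  have p01: "0 \<le> p i f \<and> p i f \<le> 1" if i: "i < n" and f: "f \<in> space MF" for i f
  proof -
    interpret prob_space "D i" by (rule D_prob_space[OF i])
    have "(\<lambda>z. l i f z) \<in> borel_measurable (D i)"
      using i f D_sets[OF i] by (intro loss_meas) (auto cong: measurable_cong_sets)
    then have "integrable (D i) (\<lambda>z. l i f z)"
      by (intro integrable_const_bound[where B=1]) (use l_range[OF i] in auto)
    then show ?thesis
      unfolding p_def using l_range[OF i] by (auto intro!: integral_nonneg integral_le_const)
  qed
  have proj_f: "(\<lambda>\<omega>. snd \<omega> i) \<in> ?M \<rightarrow>\<^sub>M MF" if "i < n" for i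
    using that M_sets by (simp cong: measurable_cong_sets)
  have proj_S: "(\<lambda>S. S i j) \<in> ?SS \<rightarrow>\<^sub>M MZ" if "i < n" "j < m i" for i j
  proof -
    have "(\<lambda>S. S i j) \<in> (\<Pi>\<^sub>M i\<in>{..<n}. \<Pi>\<^sub>M j\<in>{..<m i}. MZ) \<rightarrow>\<^sub>M MZ"
      using that measurable_component_singleton[of j "{..<m i}" "\<lambda>_. MZ"]
      by (intro measurable_PiM_component_rev[where f = "\<lambda>s. s j"]) auto
    then show ?thesis
      using SS_sets by (simp cong: measurable_cong_sets)
  qed

  have V_meas: "(\<lambda>(S, \<omega>). V S \<omega>) \<in> borel_measurable (?SS \<Otimes>\<^sub>M ?M)"
    unfolding V_def split_beta
  proof (intro borel_measurable_prod_ennreal borel_measurable_times_ennreal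
      borel_measurable_const measurable_kt_wealth)
    fix i assume "i \<in> {..<n}"
    then have i: "i < n" by simp
    have f: "(\<lambda>x. snd (snd x) i) \<in> ?SS \<Otimes>\<^sub>M ?M \<rightarrow>\<^sub>M MF"
      using measurable_compose[OF measurable_snd proj_f[OF i]] .
    show "(\<lambda>x. p i (snd (snd x) i)) \<in> borel_measurable (?SS \<Otimes>\<^sub>M ?M)"
      by (rule measurable_compose[OF f p_meas[OF i]])
    fix j assume "j < m i"
    then show "(\<lambda>x. l i (snd (snd x) i) (fst x i j)) \<in> borel_measurable (?SS \<Otimes>\<^sub>M ?M)"
      using measurable_compose[OF measurable_fst proj_S[OF i, of j]] by (intro loss_meas[OF i f]) auto
  qed

  \<comment> \<open>The predictors in \<open>\<omega>\<close> stay fixed while the sample varies, so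
    the integral factors over the independent tasks.\<close>
  have V_int: "(\<integral>\<^sup>+S. V S \<omega> \<partial>?SS) \<le> ennreal C" if \<omega>: "\<omega> \<in> space ?M" for \<omega>
  proof -
    have f: "snd \<omega> i \<in> space MF" if "i < n" for i
      using measurable_space[OF proj_f[OF that] \<omega>] .
    define w where "w i s = kt_wealth (m i) (p i (snd \<omega> i)) (\<lambda>j. l i (snd \<omega> i) (s j))" for i s
    have l_D: "l i (snd \<omega> i) \<in> borel_measurable (D i)" if "i < n" for i
      using that f[OF that] D_sets[OF that] by (intro loss_meas) (auto cong: measurable_cong_sets)
    have w_meas: "w i \<in> borel_measurable (\<Pi>\<^sub>M j\<in>{..<m i}. D i)" if "i < n" for i
      unfolding w_def
      by (rule measurable_kt_wealth[OF borel_measurable_const measurable_PiM_component_rev])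
         (use l_D[OF that] in auto)
    have "(\<integral>\<^sup>+S. V S \<omega> \<partial>?SS)
        = (\<Prod>i<n. \<integral>\<^sup>+s. ennreal (2 * sqrt (real (m i))) * w i s \<partial>(\<Pi>\<^sub>M j\<in>{..<m i}. D i))"
      unfolding V_def sample_space_def w_def[symmetric]
      by (rule nn_integral_PiM_prod) (use row_prob w_meas in \<open>auto intro!: borel_measurable_times_ennreal\<close>)
    also have "\<dots> = (\<Prod>i<n. ennreal (2 * sqrt (real (m i))) * (\<integral>\<^sup>+s. w i s \<partial>(\<Pi>\<^sub>M j\<in>{..<m i}. D i)))"
      by (intro prod.cong refl nn_integral_cmult w_meas) auto
    also have "\<dots> \<le> (\<Prod>i<n. ennreal (2 * sqrt (real (m i))) * 1)"
    proof (intro prod_mono_ennreal mult_left_mono)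
      fix i assume "i \<in> {..<n}"
      then have i: "i < n" by simp
      show "(\<integral>\<^sup>+s. w i s \<partial>(\<Pi>\<^sub>M j\<in>{..<m i}. D i)) \<le> 1"
        unfolding w_def p_def
        by (rule nn_integral_kt_wealth_le_1[OF D_prob_space[OF i] l_D[OF i] l_range[OF i]])
    qed auto
    also have "\<dots> = ennreal C"
      unfolding C_def by (simp add: prod_ennreal)
    finally show ?thesis .
  qed

  \<comment> \<open>The high-probability event\<close>
  define G where "G S = (\<integral>\<^sup>+\<omega>. V S \<omega> \<partial>?M)" for S
  have G_meas[measurable]: "G \<in> borel_measurable ?SS"
    unfolding G_def using M.borel_measurable_nn_integral[OF V_meas] by simp
  interpret pair_sigma_finite ?SS ?M ..
  have "(\<integral>\<^sup>+S. G S \<partial>?SS) = (\<integral>\<^sup>+\<omega>. \<integral>\<^sup>+S. V S \<omega> \<partial>?SS \<partial>?M)"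
    unfolding G_def using Fubini'[OF V_meas] by simp
  also have "\<dots> \<le> (\<integral>\<^sup>+\<omega>. ennreal C \<partial>?M)"
    by (intro nn_integral_mono V_int)
  also have "\<dots> = ennreal C"
    by (simp add: M.emeasure_space_1)
  finally have G_int: "(\<integral>\<^sup>+S. G S \<partial>?SS) \<le> ennreal C" .

  \<comment> \<open>The Markov event for \<open>G\<close>. It does not depend on the posteriors,
    which makes the bound simultaneous in all of them.\<close>
  define E where "E = {S \<in> space ?SS. G S \<le> ennreal (C / \<delta>)}"
  have E_sets: "E \<in> sets ?SS"
    unfolding E_def by measurable
  have "emeasure ?SS (space ?SS - E) \<le> emeasure ?SS {S \<in> space ?SS. 1 \<le> ennreal (\<delta> / C) * G S}"
  proof (intro emeasure_mono subsetI)
    fix S assume "S \<in> space ?SS - E"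
    then have S: "S \<in> space ?SS" "ennreal (C / \<delta>) \<le> G S"
      by (auto simp: E_def)
    have "1 = ennreal (\<delta> / C) * ennreal (C / \<delta>)"
      using C_pos \<delta>_pos by (simp flip: ennreal_mult')
    also have "\<dots> \<le> ennreal (\<delta> / C) * G S"
      by (intro mult_left_mono S) auto
    finally show "S \<in> {S \<in> space ?SS. 1 \<le> ennreal (\<delta> / C) * G S}"
      using S by simp
  qed measurable
  also have "\<dots> \<le> ennreal (\<delta> / C) * (\<integral>\<^sup>+S. G S * indicator (space ?SS) S \<partial>?SS)"
    by (rule nn_integral_Markov_inequality) auto
  also have "(\<integral>\<^sup>+S. G S * indicator (space ?SS) S \<partial>?SS) = (\<integral>\<^sup>+S. G S \<partial>?SS)"
    by (intro nn_integral_cong) simp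
  also have "ennreal (\<delta> / C) * (\<integral>\<^sup>+S. G S \<partial>?SS) \<le> ennreal (\<delta> / C) * ennreal C"
    by (intro mult_left_mono G_int) auto
  also have "\<dots> = ennreal \<delta>"
    using C_pos \<delta>_pos by (simp flip: ennreal_mult')
  finally have "SS.prob (space ?SS - E) \<le> \<delta>"
    using \<delta>_pos by (simp add: SS.emeasure_eq_measure)
  then have E_prob: "SS.prob E \<ge> 1 - \<delta>"
    using SS.prob_compl[OF E_sets] by simp

  \<comment> \<open>The bound on the event\<close>
  have bound: "(\<Sum>i<n. ereal (real (m i)) *
        binkl (emp_risk (l i) (m i) (S i) (Qs i)) (true_risk (l i) (D i) (Qs i)))
      \<le> KL_ext (joint_post MF n hQ Qs) ?M + ereal (ln (1 / \<delta>) + (\<Sum>i<n. ln (2 * sqrt (real (m i)))))"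
    if S: "S \<in> E" and hQ: "hQ \<in> space (prob_algebra (prob_algebra MF))"
      and Qs: "\<And>i. i < n \<Longrightarrow> Qs i \<in> space (prob_algebra MF)" for S hQ Qs
  proof (cases "KL_ext (joint_post MF n hQ Qs) ?M = \<infinity>")
    case True
    then show ?thesis by simp
  next
    case False
    let ?N = "joint_post MF n hQ Qs"
    have ac: "absolutely_continuous ?M ?N" and ent: "integrable ?N (entropy_density (exp 1) ?M ?N)"
      and KL: "KL_ext ?N ?M = ereal (KL_divergence (exp 1) ?M ?N)"
      using False by (auto simp: KL_ext_def split: if_splits)
    interpret N: prob_space ?N
      by (rule prob_space_joint_post[OF hQ Qs])
    have N_sets: "sets ?N = sets ?M"
      using sets_joint_post[OF hQ Qs] M_sets by simp
    have Q_sets: "sets (Qs i) = sets MF" and Q_prob: "prob_space (Qs i)" if "i < n" for i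
      using Qs[OF that] by (auto simp: space_prob_algebra)
    have projN: "(\<lambda>\<omega>. snd \<omega> i) \<in> ?N \<rightarrow>\<^sub>M Qs i" if i: "i < n" for i
      using proj_f[OF i] N_sets Q_sets[OF i] by (simp cong: measurable_cong_sets)
    have distr_Q: "distr ?N (Qs i) (\<lambda>\<omega>. snd \<omega> i) = Qs i" if "i < n" for i
      using that by (intro distr_joint_post[OF hQ]) (auto simp: Qs)
    have S_space: "S \<in> space ?SS" and G_le: "G S \<le> ennreal (C / \<delta>)"
      using S by (auto simp: E_def)
    have S_Z: "S i j \<in> space MZ" if "i < n" "j < m i" for i j
      using measurable_space[OF proj_S[OF that] S_space] .
    define x where "x i f = (\<Sum>j<m i. l i f (S i j)) / real (m i)" for i f
    have x01: "0 \<le> x i f \<and> x i f \<le> 1" if "i < n" for i f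
      unfolding x_def by (rule emp_mean_bounds) (use l_range m_pos that in auto)
    have x_meas: "x i \<in> borel_measurable MF" if i: "i < n" for i
      unfolding x_def
      by (intro borel_measurable_divide borel_measurable_sum borel_measurable_const loss_meas[OF i] measurable_const)
         (use S_Z[OF i] in auto)
    let ?W = "\<lambda>i f. kt_wealth (m i) (p i f) (\<lambda>j. l i f (S i j))"
    let ?good = "\<lambda>i f. (p i f = 0 \<longrightarrow> x i f = 0) \<and> (p i f = 1 \<longrightarrow> x i f = 1) \<and>
      ennreal (exp (real (m i) * real_kl (x i f) (p i f))) \<le> ennreal (2 * sqrt (real (m i))) * ?W i f"
    have dich: "?W i f = \<infinity> \<or> ?good i f" if i: "i < n" and "f \<in> space MF" for i f
      using kt_wealth_dichotomy[OF _ _ m_pos[OF i] _ x_def, of "p i f"] p01[OF that] l_range[OF i] by blast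
    have VS_meas: "V S \<in> borel_measurable ?M"
      using measurable_compose[OF measurable_Pair1'[OF S_space] V_meas] by simp
    \<comment> \<open>A finite prior mean makes \<open>V S\<close> finite almost everywhere under
      the prior, and by absolute continuity under the joint posterior; this selects the second
      alternative of \<open>dich\<close> for every task.\<close>
    have "AE \<omega> in ?M. V S \<omega> \<noteq> \<infinity>"
      using G_le by (intro nn_integral_noteq_infinite VS_meas) (auto simp: G_def top_unique)
    then have "AE \<omega> in ?N. V S \<omega> \<noteq> \<infinity>"
      using absolutely_continuous_AE[OF N_sets ac] by simp
    then have good: "AE \<omega> in ?N. \<forall>i<n. ?good i (snd \<omega> i)"
      using AE_space
    proof eventually_elim
      case (elim \<omega>)
      then have f: "snd \<omega> i \<in> space MF" if "i < n" for i
        using measurable_space[OF proj_f[OF that], of \<omega>] sets_eq_imp_space_eq[OF N_sets] by simp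
      let ?v = "\<lambda>i. ennreal (2 * sqrt (real (m i))) * ?W i (snd \<omega> i)"
      \<comment> \<open>Without this, an infinite factor could be hidden by \<open>0 * \<infinity> = 0\<close>.\<close>
      have nz: "?v i \<noteq> 0" if i: "i < n" for i
      proof -
        have "?v i = \<infinity> \<or> ennreal (exp (real (m i) * real_kl (x i (snd \<omega> i)) (p i (snd \<omega> i)))) \<le> ?v i"
          using dich[OF i f[OF i]] m_pos[OF i] by (auto simp: ennreal_mult_top)
        then show ?thesis
          using m_pos[OF i] by auto
      qed
      have "(\<Prod>i<n. ?v i) \<noteq> top"
        using elim by (simp add: V_def)
      then have "?v i \<noteq> top" if "i < n" for i
        using that nz unfolding ennreal_prod_eq_top by blast
      then have "?W i (snd \<omega> i) \<noteq> \<infinity>" if "i < n" for i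
        using that m_pos[OF that] by (fastforce simp: ennreal_mult_top)
      then show ?case
        using dich f by blast
    qed

    have ex: "\<exists>T. integrable (Qs i) T \<and> (\<integral>f. T f \<partial>Qs i) = real_kl a b \<and>
        (AE f in Qs i. T f \<le> real_kl (x i f) (p i f)) \<and> binkl a b = ereal (real_kl a b)"
      if i: "i < n" and a: "a = emp_risk (l i) (m i) (S i) (Qs i)" and b: "b = true_risk (l i) (D i) (Qs i)"
      for i a b
    proof -
      \<comment> \<open>\<open>p i f\<close> is only known to lie in \<open>[0, 1]\<close> for \<open>f\<close> in the space of \<open>MF\<close>.\<close>
      define y where "y f = (if f \<in> space MF then p i f else 0)" for f
      have y: "y f = p i f" if "f \<in> space (Qs i)" for f
        using that sets_eq_imp_space_eq[OF Q_sets[OF i]] by (simp add: y_def)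
      have xm: "x i \<in> borel_measurable (Qs i)" and pm: "p i \<in> borel_measurable (Qs i)"
        using x_meas[OF i] p_meas[OF i] Q_sets[OF i] by (simp_all cong: measurable_cong_sets)
      have ym: "y \<in> borel_measurable (Qs i)"
        using pm by (subst measurable_cong[OF y])
      have "AE f in distr ?N (Qs i) (\<lambda>\<omega>. snd \<omega> i). (p i f = 0 \<longrightarrow> x i f = 0) \<and> (p i f = 1 \<longrightarrow> x i f = 1)"
      proof (subst AE_distr_iff)
        show "(\<lambda>\<omega>. snd \<omega> i) \<in> ?N \<rightarrow>\<^sub>M Qs i"
          by (rule projN[OF i])
        show "{f \<in> space (Qs i). (p i f = 0 \<longrightarrow> x i f = 0) \<and> (p i f = 1 \<longrightarrow> x i f = 1)} \<in> sets (Qs i)"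
          using xm pm by measurable
        show "AE \<omega> in ?N. (p i (snd \<omega> i) = 0 \<longrightarrow> x i (snd \<omega> i) = 0) \<and> (p i (snd \<omega> i) = 1 \<longrightarrow> x i (snd \<omega> i) = 1)"
          using good by eventually_elim (use i in auto)
      qed
      then have AEp: "AE f in Qs i. (p i f = 0 \<longrightarrow> x i f = 0) \<and> (p i f = 1 \<longrightarrow> x i f = 1)"
        unfolding distr_Q[OF i] .
      then have AEy: "AE f in Qs i. (y f = 0 \<longrightarrow> x i f = 0) \<and> (y f = 1 \<longrightarrow> x i f = 1)"
        using AE_space by eventually_elim (simp add: y)
      have a': "a = (\<integral>f. x i f \<partial>Qs i)"
        unfolding a x_def by (rule emp_risk_eq_integral[OF Qs[OF i] l_meas[OF i] l_range[OF i] S_Z[OF i]])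
      have "b = (\<integral>f. p i f \<partial>Qs i)"
        unfolding b p_def by (rule true_risk_eq_integral[OF Qs[OF i] D_prob[OF i] l_meas[OF i] l_range[OF i]])
      then have b': "b = (\<integral>f. y f \<partial>Qs i)"
        by (simp add: y cong: Bochner_Integration.integral_cong)
      have y01: "0 \<le> y f \<and> y f \<le> 1" for f
        using p01[OF i] by (simp add: y_def)
      obtain T where T: "integrable (Qs i) T" "(\<integral>f. T f \<partial>Qs i) = real_kl a b"
          "AE f in Qs i. T f \<le> real_kl (x i f) (y f)" "b = 0 \<Longrightarrow> a = 0" "b = 1 \<Longrightarrow> a = 1"
        using kl_tangent[OF Q_prob[OF i] xm ym x01[OF i] y01 AEy a' b'] by blast
      have "AE f in Qs i. T f \<le> real_kl (x i f) (p i f)"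
        using T(3) AE_space by eventually_elim (simp add: y)
      with T binkl_eq_real_kl[OF T(4,5)] show ?thesis
        by blast
    qed
    define a where "a i = emp_risk (l i) (m i) (S i) (Qs i)" for i
    define b where "b i = true_risk (l i) (D i) (Qs i)" for i
    obtain T where T: "\<And>i. i < n \<Longrightarrow> integrable (Qs i) (T i) \<and> (\<integral>f. T i f \<partial>Qs i) = real_kl (a i) (b i) \<and>
        (AE f in Qs i. T i f \<le> real_kl (x i f) (p i f)) \<and> binkl (a i) (b i) = ereal (real_kl (a i) (b i))"
      using ex[OF _ a_def b_def] by metis
    \<comment> \<open>The mean of \<open>\<phi>\<close> under the joint posterior is the left side
      of the claim, and \<open>exp \<phi>\<close> lies almost everywhere below
      \<open>V S\<close>.\<close>
    define \<phi> where "\<phi> \<omega> = (\<Sum>i<n. real (m i) * T i (snd \<omega> i))" for \<omega> :: "'f measure \<times> (nat \<Rightarrow> 'f)"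
    have T_N: "integrable ?N (\<lambda>\<omega>. T i (snd \<omega> i))" "(\<integral>\<omega>. T i (snd \<omega> i) \<partial>?N) = real_kl (a i) (b i)"
      "AE \<omega> in ?N. T i (snd \<omega> i) \<le> real_kl (x i (snd \<omega> i)) (p i (snd \<omega> i))" if i: "i < n" for i
    proof -
      have Tm: "T i \<in> borel_measurable (Qs i)"
        using T[OF i] by auto
      show "integrable ?N (\<lambda>\<omega>. T i (snd \<omega> i))"
        using integrable_distr_eq[OF projN[OF i] Tm] T[OF i] distr_Q[OF i] by simp
      show "(\<integral>\<omega>. T i (snd \<omega> i) \<partial>?N) = real_kl (a i) (b i)"
        using integral_distr[OF projN[OF i] Tm] T[OF i] distr_Q[OF i] by simp
      show "AE \<omega> in ?N. T i (snd \<omega> i) \<le> real_kl (x i (snd \<omega> i)) (p i (snd \<omega> i))"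
        using AE_distrD[OF projN[OF i], unfolded distr_Q[OF i]] T[OF i] by blast
    qed
    have \<phi>_int: "integrable ?N \<phi>"
      unfolding \<phi>_def by (intro Bochner_Integration.integrable_sum integrable_mult_right T_N) auto
    have \<phi>_eq: "(\<integral>\<omega>. \<phi> \<omega> \<partial>?N) = (\<Sum>i<n. real (m i) * real_kl (a i) (b i))"
      unfolding \<phi>_def using T_N by simp
    have "AE \<omega> in ?N. \<forall>i\<in>{..<n}. T i (snd \<omega> i) \<le> real_kl (x i (snd \<omega> i)) (p i (snd \<omega> i))"
      using T_N(3) by (intro AE_finite_allI) auto
    with good have le: "AE \<omega> in ?N. ennreal (exp (\<phi> \<omega>)) \<le> V S \<omega>"
    proof eventually_elim
      case (elim \<omega>)
      have "ennreal (exp (\<phi> \<omega>)) = (\<Prod>i<n. ennreal (exp (real (m i) * T i (snd \<omega> i))))"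
        by (simp add: \<phi>_def exp_sum prod_ennreal)
      also have "\<dots> \<le> V S \<omega>"
        unfolding V_def
      proof (rule prod_mono_ennreal)
        fix i assume "i \<in> {..<n}"
        then have "ennreal (exp (real (m i) * T i (snd \<omega> i)))
            \<le> ennreal (exp (real (m i) * real_kl (x i (snd \<omega> i)) (p i (snd \<omega> i))))"
          using elim by (auto intro!: ennreal_leI mult_left_mono)
        also have "\<dots> \<le> ennreal (2 * sqrt (real (m i))) * ?W i (snd \<omega> i)"
          using elim \<open>i \<in> {..<n}\<close> by blast
        finally show "ennreal (exp (real (m i) * T i (snd \<omega> i)))
            \<le> ennreal (2 * sqrt (real (m i))) * ?W i (snd \<omega> i)" .
      qed
      finally show ?case .
    qed
    \<comment> \<open>Membership in \<open>E\<close> bounds the prior mean of \<open>V S\<close> by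
      \<open>C / \<delta>\<close>, whose logarithm gives the terms besides the divergence.\<close>
    have "(\<integral>\<omega>. \<phi> \<omega> \<partial>?N) \<le> KL_divergence (exp 1) ?M ?N + ln (C / \<delta>)"
      using G_le C_pos \<delta>_pos
      by (intro donsker_varadhan[OF M.prob_space_axioms N.prob_space_axioms N_sets ac ent \<phi>_int VS_meas _ _ le])
         (auto simp: G_def)
    also have "ln (C / \<delta>) = ln (1 / \<delta>) + (\<Sum>i<n. ln (2 * sqrt (real (m i))))"
    proof -
      have "ln C = (\<Sum>i<n. ln (2 * sqrt (real (m i))))"
        unfolding C_def by (rule ln_prod) (use m_pos in \<open>auto simp: Suc_le_eq\<close>)
      then show ?thesis
        using C_pos \<delta>_pos by (simp add: ln_div)
    qed
    finally have "(\<Sum>i<n. real (m i) * real_kl (a i) (b i))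
        \<le> KL_divergence (exp 1) ?M ?N + (ln (1 / \<delta>) + (\<Sum>i<n. ln (2 * sqrt (real (m i)))))"
      unfolding \<phi>_eq .
    moreover have "(\<Sum>i<n. ereal (real (m i)) * binkl (a i) (b i)) = ereal (\<Sum>i<n. real (m i) * real_kl (a i) (b i))"
      using T by (simp flip: sum_ereal)
    ultimately show ?thesis
      unfolding KL a_def b_def by simp
  qed
  show ?thesis
    using E_sets E_prob bound by (intro bexI[of _ E]) auto
qed

end
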